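(* Let $1\le k\le n$ and let $\ell:\mathbb{R}^n\to\mathbb{R}$ be any linear functional such that $\ell(\vec 1)\ge0$. Then the polynomial $e_k(x)+\ell(x)e_{k-1}(x)$ is hyperbolic with respect to $\vec 1$, and its hyperbolicity cone is spectrahedral.
   Context: $\vec 1=(1,\dots,1)\in\mathbb{R}^n$ and $e_k$ is the $k$-th elementary symmetric polynomial in $x_1,\dots,x_n$ ($e_0=1$). A homogeneous $p\in\mathbb{R}[x_1,\dots,x_n]$ is hyperbolic with respect to $v\in\mathbb{R}^n$ if $p(v)\ne0$ and for every $x\in\mathbb{R}^n$ the univariate polynomial $p(x+tv)$ in $t$ has only real roots. Its hyperbolicity cone (with respect to $v$) is $H_v(p)=\{x\in\mathbb{R}^n: p(x+tv)\ne0\text{ for all }t>0\}$. The cone $H_v(p)$ is spectrahedral if for some $m\in\mathbb{N}$ there are real symmetric $m\times m$ matrices $A_1,\dots,A_n$ with $H_v(p)=\{x\in\mathbb{R}^n:\sum_{i=1}^nA_ix_i\succeq0\}$. *)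

theory Defs
  imports
    "HOL-Analysis.Analysis"
    "HOL-Library.Poly_Mapping"
    "HOL-Computational_Algebra.Polynomial"
    "Jordan_Normal_Form.Matrix"
begin

text \<open>
  The symbols \<open>$\<close> and \<open>\<bullet>\<close> refer to points of \<open>real ^ 'n\<close>; for the vectors of
  \<^theory>\<open>Jordan_Normal_Form.Matrix\<close> the constants \<^const>\<open>vec_index\<close> and
  \<^const>\<open>scalar_prod\<close> are written out.
\<close>

no_notation vec_index (infixl \<open>$\<close> 100)
no_notation scalar_prod (infix \<open>\<bullet>\<close> 70)


subsection \<open>Polynomials in finitely many variables\<close>

text \<open>
  Polynomials with real coefficients in variables indexed by the finite type \<open>'n\<close>, as finitely
  supported maps from exponent vectors to coefficients; the ring structure is the convolution
  product of \<^theory>\<open>HOL-Library.Poly_Mapping\<close>.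
\<close>

type_synonym 'n real_mpoly = "('n \<Rightarrow>\<^sub>0 nat) \<Rightarrow>\<^sub>0 real"

definition mvar :: "'n \<Rightarrow> 'n real_mpoly" where
  "mvar i = Poly_Mapping.single (Poly_Mapping.single i 1) 1"

definition mconst :: "real \<Rightarrow> 'n real_mpoly" where
  "mconst c = Poly_Mapping.single 0 c"

text \<open>Substitution of \<open>a i\<close> for the \<open>i\<close>-th variable, coefficients being mapped by \<open>c\<close>.\<close>

definition mpoly_subst ::
    "(real \<Rightarrow> 'b) \<Rightarrow> ('n :: finite \<Rightarrow> 'b) \<Rightarrow> 'n real_mpoly \<Rightarrow> 'b :: comm_semiring_1" where
  "mpoly_subst c a p =
     (\<Sum>m \<in> Poly_Mapping.keys p.
        c (Poly_Mapping.lookup p m) * (\<Prod>i\<in>UNIV. a i ^ Poly_Mapping.lookup m i))"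

definition mpoly_eval :: "'n :: finite real_mpoly \<Rightarrow> real ^ 'n \<Rightarrow> real" where
  "mpoly_eval p x = mpoly_subst (\<lambda>c. c) (\<lambda>i. x $ i) p"

text \<open>The univariate polynomial \<open>p(x + t v)\<close> in \<open>t\<close>.\<close>

definition line_restriction ::
    "'n :: finite real_mpoly \<Rightarrow> real ^ 'n \<Rightarrow> real ^ 'n \<Rightarrow> real poly" where
  "line_restriction p x v = mpoly_subst (\<lambda>c. [:c:]) (\<lambda>i. [:x $ i, v $ i:]) p"

definition homogeneous :: "'n :: finite real_mpoly \<Rightarrow> bool" where
  "homogeneous p \<longleftrightarrow>
     (\<exists>d. \<forall>m \<in> Poly_Mapping.keys p. (\<Sum>i\<in>UNIV. Poly_Mapping.lookup m i) = d)"

definition elem_sym :: "nat \<Rightarrow> 'n :: finite real_mpoly" where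
  "elem_sym k = (\<Sum>S | card S = k. \<Prod>i\<in>S. mvar i)"

text \<open>
  A linear functional on \<open>real ^ 'n\<close> as a linear form; the coefficients are its values on the
  standard basis.
\<close>

definition linear_form :: "(real ^ 'n \<Rightarrow> real) \<Rightarrow> 'n :: finite real_mpoly" where
  "linear_form l = (\<Sum>i\<in>UNIV. mconst (l (axis i 1)) * mvar i)"


subsection \<open>Hyperbolicity\<close>

definition only_real_roots :: "real poly \<Rightarrow> bool" where
  "only_real_roots q \<longleftrightarrow> (\<forall>z :: complex. poly (map_poly of_real q) z = 0 \<longrightarrow> z \<in> \<real>)"

definition hyperbolic :: "'n :: finite real_mpoly \<Rightarrow> real ^ 'n \<Rightarrow> bool" where
  "hyperbolic p v \<longleftrightarrow>
     homogeneous p \<and> mpoly_eval p v \<noteq> 0 \<and> (\<forall>x. only_real_roots (line_restriction p x v))"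

definition hyperbolicity_cone :: "real ^ 'n \<Rightarrow> 'n :: finite real_mpoly \<Rightarrow> (real ^ 'n) set" where
  "hyperbolicity_cone v p = {x. \<forall>t>0. mpoly_eval p (x + t *\<^sub>R v) \<noteq> 0}"


subsection \<open>Spectrahedral cones\<close>

definition symmetric_mat :: "'a mat \<Rightarrow> bool" where
  "symmetric_mat A \<longleftrightarrow> transpose_mat A = A"

definition psd_mat :: "real mat \<Rightarrow> bool" where
  "psd_mat A \<longleftrightarrow>
     symmetric_mat A \<and> (\<forall>v \<in> carrier_vec (dim_row A). 0 \<le> scalar_prod v (A *\<^sub>v v))"

text \<open>
  The sum of the matrices \<open>x $ i \<cdot>\<^sub>m A i\<close>, written entrywise because the type of matrices of all
  sizes is not an additive monoid.
\<close>

definition mat_pencil :: "nat \<Rightarrow> ('n :: finite \<Rightarrow> real mat) \<Rightarrow> real ^ 'n \<Rightarrow> real mat" where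
  "mat_pencil m A x = mat m m (\<lambda>(r, c). \<Sum>i\<in>UNIV. x $ i * A i $$ (r, c))"

definition spectrahedral :: "(real ^ 'n :: finite) set \<Rightarrow> bool" where
  "spectrahedral C \<longleftrightarrow>
     (\<exists>m A. (\<forall>i. A i \<in> carrier_mat m m \<and> symmetric_mat (A i)) \<and>
            C = {x. psd_mat (mat_pencil m A x)})"

end

theory Submission
  imports Defs
begin

text \<open>
  The ratio \<open>f\<^sub>k = e\<^sub>k / e\<^sub>k\<^sub>-\<^sub>1\<close> satisfies
  \<open>k f\<^sub>k(x) = \<Sum>i. x\<^sub>i \<parallel> f\<^sub>k\<^sub>-\<^sub>1(x without x\<^sub>i)\<close> with the parallel sum
  \<open>a \<parallel> b = a b / (a + b)\<close>. Parallel sums preserve the upper half plane, so \<open>f\<^sub>k + l\<close> has no zeros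
  \<open>x + t 1\<close> with \<open>Im t > 0\<close>, which is hyperbolicity. Over the reals \<open>f\<^sub>k\<close> is the
  effective conductance of a series-parallel network whose edges are positive multiples of the
  variables, i.e. the minimum of the energy, a quadratic form linear in \<open>x\<close>, over all potentials
  with value 1 at the root. Adding \<open>l x\<close> times the squared root potential to the energy
  gives the linear matrix inequality that describes the hyperbolicity cone.
\<close>

subsection \<open>Elementary symmetric functions\<close>

text \<open>Index set and ring are kept general: the induction deletes elements from
  \<open>S\<close>, and values are needed both in the reals and in the complex numbers.\<close>

definition esym :: "nat \<Rightarrow> 'a set \<Rightarrow> ('a \<Rightarrow> 'b :: comm_ring_1) \<Rightarrow> 'b" where
  "esym k S f = (\<Sum>T | T \<subseteq> S \<and> card T = k. \<Prod>i\<in>T. f i)"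

lemma esym_0:
  assumes "finite S"
  shows "esym 0 S f = 1"
proof -
  have "{T. T \<subseteq> S \<and> card T = 0} = {{}}"
    using assms by (auto dest: finite_subset)
  then show ?thesis by (simp add: esym_def)
qed

text \<open>The \<open>Suc k\<close>-subsets of \<open>S\<close> are sorted by whether they contain
  \<open>i\<close>.\<close>

lemma esym_Suc_remove:
  assumes "finite S" and "i \<in> S"
  shows "esym (Suc k) S f = esym (Suc k) (S - {i}) f + f i * esym k (S - {i}) f"
proof -
  have split: "{T. T \<subseteq> S \<and> card T = Suc k} =
      {T. T \<subseteq> S - {i} \<and> card T = Suc k} \<union> insert i ` {T. T \<subseteq> S - {i} \<and> card T = k}"
    (is "?L = ?A \<union> insert i ` ?B")
  proof (intro equalityI subsetI)
    fix T assume T: "T \<in> ?L"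
    show "T \<in> ?A \<union> insert i ` ?B"
    proof (cases "i \<in> T")
      case True
      have "T = insert i (T - {i})" "T - {i} \<in> ?B"
        using True T assms(1) by (auto dest: finite_subset simp: card_Diff_singleton)
      then show ?thesis by blast
    qed (use T in auto)
  next
    fix T assume "T \<in> ?A \<union> insert i ` ?B"
    moreover have "card (insert i U) = Suc k" if "U \<in> ?B" for U
    proof -
      have "finite U" "i \<notin> U" using that assms(1) by (auto dest: finite_subset)
      then show ?thesis using that by simp
    qed
    ultimately show "T \<in> ?L" using assms(2) by auto
  qed
  have fin: "finite ?A" "finite ?B" using assms(1) by auto
  have inj: "inj_on (insert i) ?B" by (auto simp: inj_on_def)
  have "esym (Suc k) S f = (\<Sum>T\<in>?A. \<Prod>i\<in>T. f i) + (\<Sum>T\<in>insert i ` ?B. \<Prod>i\<in>T. f i)"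
    unfolding esym_def split by (rule sum.union_disjoint) (use fin in auto)
  also have "(\<Sum>T\<in>insert i ` ?B. \<Prod>i\<in>T. f i) = (\<Sum>T\<in>?B. \<Prod>i\<in>insert i T. f i)"
    using sum.reindex[OF inj] by simp
  also have "\<dots> = (\<Sum>T\<in>?B. f i * (\<Prod>i\<in>T. f i))"
  proof (rule sum.cong)
    fix U assume U: "U \<in> ?B"
    have "finite U" "i \<notin> U" using U assms(1) by (auto dest: finite_subset)
    then show "prod f (insert i U) = f i * prod f U" by simp
  qed simp
  finally show ?thesis by (simp add: esym_def sum_distrib_left)
qed

text \<open>Double counting: each \<open>U\<close> of size \<open>Suc k\<close> arises as
  \<open>insert i T\<close> once for each of its elements \<open>i\<close>.\<close>

lemma esym_Suc_sum:
  assumes "finite S"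
  shows "of_nat (Suc k) * esym (Suc k) S f = (\<Sum>i\<in>S. f i * esym k (S - {i}) f)"
proof -
  have "(\<Sum>i\<in>S. f i * esym k (S - {i}) f)
      = (\<Sum>i\<in>S. \<Sum>T | T \<subseteq> S - {i} \<and> card T = k. f i * (\<Prod>j\<in>T. f j))"
    by (simp add: esym_def sum_distrib_left)
  also have "\<dots> = (\<Sum>i\<in>S. \<Sum>U | U \<subseteq> S \<and> card U = Suc k \<and> i \<in> U. \<Prod>j\<in>U. f j)"
  proof (rule sum.cong)
    fix i assume i: "i \<in> S"
    show "(\<Sum>T | T \<subseteq> S - {i} \<and> card T = k. f i * (\<Prod>j\<in>T. f j)) =
        (\<Sum>U | U \<subseteq> S \<and> card U = Suc k \<and> i \<in> U. \<Prod>j\<in>U. f j)"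
    proof (rule sum.reindex_bij_witness[where i = "\<lambda>U. U - {i}" and j = "insert i"])
      fix T assume T: "T \<in> {T. T \<subseteq> S - {i} \<and> card T = k}"
      then have "finite T" "i \<notin> T" using assms by (auto dest: finite_subset)
      then show "insert i T - {i} = T" "insert i T \<in> {U. U \<subseteq> S \<and> card U = Suc k \<and> i \<in> U}"
        "prod f (insert i T) = f i * prod f T"
        using T i by auto
    qed (use assms in \<open>auto dest: finite_subset simp: card_Diff_singleton\<close>)
  qed simp
  also have "\<dots> = (\<Sum>i\<in>S. \<Sum>U | U \<subseteq> S \<and> card U = Suc k. if i \<in> U then \<Prod>j\<in>U. f j else 0)"
  proof (rule sum.cong)
    fix i
    have "{U. U \<subseteq> S \<and> card U = Suc k \<and> i \<in> U} = {U \<in> {U. U \<subseteq> S \<and> card U = Suc k}. i \<in> U}"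
      by auto
    then show "(\<Sum>U | U \<subseteq> S \<and> card U = Suc k \<and> i \<in> U. \<Prod>j\<in>U. f j) =
        (\<Sum>U | U \<subseteq> S \<and> card U = Suc k. if i \<in> U then \<Prod>j\<in>U. f j else 0)"
      using sum.inter_filter[of "{U. U \<subseteq> S \<and> card U = Suc k}" "prod f" "\<lambda>U. i \<in> U"] assms
      by simp
  qed simp
  also have "\<dots> = (\<Sum>U | U \<subseteq> S \<and> card U = Suc k. \<Sum>i\<in>S. if i \<in> U then \<Prod>j\<in>U. f j else 0)"
    by (rule sum.swap)
  also have "\<dots> = (\<Sum>U | U \<subseteq> S \<and> card U = Suc k. of_nat (Suc k) * (\<Prod>j\<in>U. f j))"
  proof (rule sum.cong)
    fix U assume "U \<in> {U. U \<subseteq> S \<and> card U = Suc k}"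
    moreover from this have "{i \<in> S. i \<in> U} = U" by auto
    ultimately show "(\<Sum>i\<in>S. if i \<in> U then \<Prod>j\<in>U. f j else 0) = of_nat (Suc k) * (\<Prod>j\<in>U. f j)"
      using assms by (simp flip: sum.inter_filter)
  qed simp
  finally show ?thesis by (simp add: esym_def sum_distrib_left)
qed

lemma esym_1:
  assumes "finite S"
  shows "esym (Suc 0) S f = (\<Sum>i\<in>S. f i)"
  using esym_Suc_sum[OF assms, of 0 f] assms by (simp add: esym_0)

text \<open>A \<open>k\<close>-subset survives exactly \<open>card S - k\<close> of the deletions.
  The term with factor \<open>k\<close> stands on the left to avoid truncated subtraction. The
  identity later carries positivity from all deletions back to \<open>S\<close>.\<close>

lemma sum_esym_remove:
  assumes "finite S"
  shows "(\<Sum>i\<in>S. esym k (S - {i}) f) + of_nat k * esym k S f = of_nat (card S) * esym k S f"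
proof (cases k)
  case 0
  then show ?thesis using assms by (simp add: esym_0)
next
  case (Suc m)
  have "(\<Sum>i\<in>S. esym k (S - {i}) f) + of_nat k * esym k S f
      = (\<Sum>i\<in>S. esym k (S - {i}) f + f i * esym m (S - {i}) f)"
    using esym_Suc_sum[OF assms, of m f] Suc by (simp add: sum.distrib)
  also have "\<dots> = (\<Sum>i\<in>S. esym k S f)"
    by (rule sum.cong) (use esym_Suc_remove[OF assms, of _ m f] Suc in auto)
  finally show ?thesis by simp
qed

lemma esym_scale: "esym k S (\<lambda>i. c * f i) = c ^ k * esym k S f"
  by (auto simp: esym_def sum_distrib_left prod.distrib intro!: sum.cong)

lemma esym_cnj: "esym k S (\<lambda>i. cnj (f i)) = cnj (esym k S f)"
  by (simp add: esym_def)

lemma esym_pos: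
  fixes f :: "'a \<Rightarrow> 'b :: linordered_idom"
  assumes "finite S" and "\<And>i. i \<in> S \<Longrightarrow> f i > 0" and "k \<le> card S"
  shows "esym k S f > 0"
proof -
  obtain T where "T \<subseteq> S" "card T = k"
    using obtain_subset_with_card_n[OF assms(3)] by blast
  then have "{T. T \<subseteq> S \<and> card T = k} \<noteq> {}" by blast
  then show ?thesis
    unfolding esym_def using assms(1,2) by (intro sum_pos prod_pos) auto
qed


subsection \<open>The ratio of consecutive elementary symmetric functions\<close>

text \<open>
  Writing \<open>R = esym (k + 1) (S - {i}) f / esym k (S - {i}) f\<close>, each summand on the right is
  the parallel sum \<open>f i * R / (f i + R)\<close>.
\<close>

lemma esym_ratio:
  fixes f :: "'a \<Rightarrow> 'b :: field_char_0"
  assumes "finite S"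
    and "\<And>i. i \<in> S \<Longrightarrow> esym k (S - {i}) f \<noteq> 0" and "esym (Suc k) S f \<noteq> 0"
  shows "of_nat (k + 2) * (esym (Suc (Suc k)) S f / esym (Suc k) S f) =
    (\<Sum>i\<in>S. f i * (esym (Suc k) (S - {i}) f / esym k (S - {i}) f) /
      (f i + esym (Suc k) (S - {i}) f / esym k (S - {i}) f))"
proof -
  have "of_nat (k + 2) * (esym (Suc (Suc k)) S f / esym (Suc k) S f) =
      (\<Sum>i\<in>S. f i * esym (Suc k) (S - {i}) f) / esym (Suc k) S f"
    using esym_Suc_sum[OF assms(1), of "Suc k" f] by simp
  also have "\<dots> = (\<Sum>i\<in>S. f i * esym (Suc k) (S - {i}) f / esym (Suc k) S f)"
    by (rule sum_divide_distrib)
  also have "\<dots> = (\<Sum>i\<in>S. f i * (esym (Suc k) (S - {i}) f / esym k (S - {i}) f) /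
      (f i + esym (Suc k) (S - {i}) f / esym k (S - {i}) f))"
  proof (rule sum.cong)
    fix i assume i: "i \<in> S"
    \<comment> \<open>The deletion identity, divided by \<open>esym k (S - {i}) f\<close>, gives the
      denominator of the parallel sum in closed form, so the factors of order \<open>k\<close>
      cancel.\<close>
    have "f i + esym (Suc k) (S - {i}) f / esym k (S - {i}) f = esym (Suc k) S f / esym k (S - {i}) f"
      using assms(2)[OF i] esym_Suc_remove[OF assms(1) i, of k f] by (simp add: field_simps)
    then show "f i * esym (Suc k) (S - {i}) f / esym (Suc k) S f =
      f i * (esym (Suc k) (S - {i}) f / esym k (S - {i}) f) /
      (f i + esym (Suc k) (S - {i}) f / esym k (S - {i}) f)"
      using assms(2)[OF i] assms(3) by simp
  qed simp
  finally show ?thesis .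
qed

lemma Im_inverse_neg: "Im z > 0 \<Longrightarrow> Im (inverse z) < 0"
  by (auto simp: sum_power2_gt_zero_iff intro!: divide_neg_pos)

text \<open>The parallel sum is the inverse of the sum of the inverses, and inversion exchanges the
  upper and lower half planes.\<close>

lemma Im_parallel_pos:
  assumes "Im a > 0" and "Im b > 0"
  shows "Im (a * b / (a + b)) > 0"
proof -
  have nz: "a \<noteq> 0" "b \<noteq> 0" "a + b \<noteq> 0" using assms by (auto simp: complex_eq_iff)
  have "a * b / (a + b) = inverse (inverse a + inverse b)"
    using nz by (simp add: field_simps)
  moreover have "Im (inverse a + inverse b) < 0"
    using Im_inverse_neg[OF assms(1)] Im_inverse_neg[OF assms(2)] by simp
  then have "Im (inverse (inverse a + inverse b)) > 0"
    using Im_inverse_neg[of "- (inverse a + inverse b)"]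
    by (metis add.inverse_inverse inverse_minus_eq neg_0_less_iff_less neg_less_0_iff_less uminus_complex.sel(2))
  ultimately show ?thesis by simp
qed

text \<open>Both claims go through one induction on \<open>k\<close>. The number
  \<open>f i + ?R i\<close> lies in the upper half plane and has \<open>esym (Suc k) S f\<close> as
  numerator, which gives the nonvanishing; the new ratio is then a positive multiple of a sum of
  parallel sums.\<close>

lemma esym_upper_half_plane:
  assumes "finite S" and "\<And>i. i \<in> S \<Longrightarrow> Im (f i) > 0" and "Suc k \<le> card S"
  shows "esym k S f \<noteq> 0 \<and> Im (esym (Suc k) S f / esym k S f) > 0"
  using assms
proof (induction k arbitrary: S)
  case 0
  then have "S \<noteq> {}" by auto
  then have "Im (\<Sum>i\<in>S. f i) > 0" using 0 by (simp add: Im_sum sum_pos)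
  then show ?case using 0 by (simp add: esym_0 esym_1)
next
  case (Suc k)
  let ?R = "\<lambda>i. esym (Suc k) (S - {i}) f / esym k (S - {i}) f"
  have IH: "esym k (S - {i}) f \<noteq> 0" "Im (?R i) > 0" if "i \<in> S" for i
    using Suc.IH[of "S - {i}"] Suc.prems that by (auto simp: card_Diff_singleton)
  have ne: "S \<noteq> {}" using Suc.prems by auto
  then obtain i where i: "i \<in> S" by blast
  have "Im (f i + ?R i) > 0" using IH(2)[OF i] Suc.prems(2)[OF i] by simp
  moreover have "f i + ?R i = esym (Suc k) S f / esym k (S - {i}) f"
    using IH(1)[OF i] esym_Suc_remove[OF Suc.prems(1) i, of k f] by (simp add: field_simps)
  ultimately have nz: "esym (Suc k) S f \<noteq> 0" by auto
  have "Im (of_nat (k + 2) * (esym (Suc (Suc k)) S f / esym (Suc k) S f)) =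
      (\<Sum>i\<in>S. Im (f i * ?R i / (f i + ?R i)))"
    using arg_cong[OF esym_ratio[of S k f, OF Suc.prems(1) IH(1) nz], of Im]
    by (simp only: Im_sum)
  also have "\<dots> > 0"
    by (intro sum_pos Im_parallel_pos) (use Suc.prems IH ne in auto)
  finally have "real (k + 2) * Im (esym (Suc (Suc k)) S f / esym (Suc k) S f) > 0"
    by (metis Im_complex_of_real Re_complex_of_real add_0 times_complex.sel(2) mult_zero_left
        add.right_neutral of_real_of_nat_eq)
  then have "Im (esym (Suc (Suc k)) S f / esym (Suc k) S f) > 0"
    by (simp add: zero_less_mult_iff)
  then show ?case using nz by blast
qed


subsection \<open>A network whose conductance is the ratio\<close>

text \<open>Each deleted element lowers the admissible order by one. The case
  \<open>j + card (S - T) = m\<close> collects the denominators that occur at all levels of the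
  recursion for the ratio.\<close>

definition esym_pos_upto :: "nat \<Rightarrow> 'a set \<Rightarrow> ('a \<Rightarrow> real) \<Rightarrow> bool" where
  "esym_pos_upto m S f \<longleftrightarrow> (\<forall>T j. T \<subseteq> S \<and> j + card (S - T) \<le> m \<longrightarrow> esym j T f > 0)"

definition esym_nonneg_upto :: "nat \<Rightarrow> 'a set \<Rightarrow> ('a \<Rightarrow> real) \<Rightarrow> bool" where
  "esym_nonneg_upto m S f \<longleftrightarrow> (\<forall>T j. T \<subseteq> S \<and> j + card (S - T) \<le> m \<longrightarrow> esym j T f \<ge> 0)"

lemma card_Diff_remove:
  assumes "finite S" and "i \<in> S" and "T \<subseteq> S - {i}"
  shows "card (S - T) = Suc (card (S - {i} - T))"
proof -
  have "S - T = insert i (S - {i} - T)" using assms by auto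
  then show ?thesis using assms(1) by (metis Diff_iff card_insert_disjoint finite_Diff singletonI)
qed

lemma
  assumes "finite S" and "i \<in> S"
  shows esym_pos_upto_remove: "esym_pos_upto (Suc m) S f \<Longrightarrow> esym_pos_upto m (S - {i}) f"
    and esym_nonneg_upto_remove: "esym_nonneg_upto (Suc m) S f \<Longrightarrow> esym_nonneg_upto m (S - {i}) f"
proof -
  have "T \<subseteq> S \<and> j + card (S - T) \<le> Suc m" if "T \<subseteq> S - {i} \<and> j + card (S - {i} - T) \<le> m" for T j
    using card_Diff_remove[OF assms, of T] that by auto
  then show "esym_pos_upto (Suc m) S f \<Longrightarrow> esym_pos_upto m (S - {i}) f"
    and "esym_nonneg_upto (Suc m) S f \<Longrightarrow> esym_nonneg_upto m (S - {i}) f"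
    unfolding esym_pos_upto_def esym_nonneg_upto_def by blast+
qed

lemma esym_nonneg_upto_le: "esym_nonneg_upto m S f \<Longrightarrow> n \<le> m \<Longrightarrow> esym_nonneg_upto n S f"
  by (simp add: esym_nonneg_upto_def)

lemma
  shows esym_pos_uptoD: "esym_pos_upto m S f \<Longrightarrow> j \<le> m \<Longrightarrow> esym j S f > 0"
    and esym_nonneg_uptoD: "esym_nonneg_upto m S f \<Longrightarrow> j \<le> m \<Longrightarrow> esym j S f \<ge> 0"
  by (auto simp: esym_pos_upto_def esym_nonneg_upto_def)

text \<open>Introduction rule for inductions on \<open>m\<close>: the subset \<open>T = S\<close> is
  treated directly, and every proper subset lies in some \<open>S - {i}\<close>.\<close>

lemma esym_pos_uptoI:
  assumes "finite S" and "\<And>j. j \<le> m \<Longrightarrow> esym j S f > 0"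
    and "\<And>i n. i \<in> S \<Longrightarrow> m = Suc n \<Longrightarrow> esym_pos_upto n (S - {i}) f"
  shows "esym_pos_upto m S f"
  unfolding esym_pos_upto_def
proof (intro allI impI)
  fix T j assume T: "T \<subseteq> S \<and> j + card (S - T) \<le> m"
  show "esym j T f > 0"
  proof (cases "T = S")
    case False
    then obtain i where i: "i \<in> S" "T \<subseteq> S - {i}" using T by blast
    have c: "card (S - T) = Suc (card (S - {i} - T))"
      by (rule card_Diff_remove[OF assms(1) i])
    then obtain n where n: "m = Suc n" using T by (cases m) auto
    have "j + card (S - {i} - T) \<le> n" using T c n by simp
    then show ?thesis
      using assms(3)[OF i(1) n] i(2) unfolding esym_pos_upto_def by blast
  qed (use T assms(2) in auto)
qed

text \<open>Because \<open>f i * esym m (S - {i}) f = f i * (esym m S f - f i * esym (m - 1) (S - {i}) f)\<close>.\<close>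

lemma esym_Suc_le:
  assumes "finite S" and "esym_nonneg_upto m S f"
  shows "real (Suc m) * esym (Suc m) S f \<le> (\<Sum>i\<in>S. f i) * esym m S f"
proof (cases m)
  case 0
  then show ?thesis using assms(1) by (simp add: esym_1 esym_0)
next
  case (Suc n)
  have "real (Suc m) * esym (Suc m) S f = (\<Sum>i\<in>S. f i * esym m (S - {i}) f)"
    using esym_Suc_sum[OF assms(1), of m f] by simp
  also have "\<dots> \<le> (\<Sum>i\<in>S. f i * esym m S f)"
  proof (rule sum_mono)
    fix i assume i: "i \<in> S"
    have "esym n (S - {i}) f \<ge> 0"
      using esym_nonneg_uptoD esym_nonneg_upto_remove[OF assms(1) i] assms(2) Suc by blast
    then have "f i * f i * esym n (S - {i}) f \<ge> 0" by simp
    then show "f i * esym m (S - {i}) f \<le> f i * esym m S f"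
      using esym_Suc_remove[OF assms(1) i, of n f] Suc by (simp add: algebra_simps)
  qed
  finally show ?thesis by (simp add: sum_distrib_right)
qed

text \<open>By \<open>esym_Suc_le\<close>, a zero at order \<open>m\<close> forces the value at
  order \<open>m + 1\<close> to be at most 0. Hence positivity at the top order descends to lower
  orders. It also passes to deletions, since a zero there would make \<open>esym (Suc m) S f\<close>
  nonpositive by the deletion identity.\<close>

lemma esym_nonneg_upto_imp_pos:
  assumes "finite S" and "esym_nonneg_upto m S f" and "esym m S f > 0"
  shows "esym_pos_upto m S f"
  using assms
proof (induction m arbitrary: S)
  case 0
  show ?case by (rule esym_pos_uptoI) (use 0 in auto)
next
  case (Suc m)
  have nn: "esym_nonneg_upto m S f" using Suc.prems(2) by (rule esym_nonneg_upto_le) simp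
  have "real (Suc m) * esym (Suc m) S f > 0" using Suc.prems(3) by simp
  then have "esym m S f \<noteq> 0" using esym_Suc_le[OF Suc.prems(1) nn] by auto
  then have *: "esym_pos_upto m S f"
    using Suc.IH[OF Suc.prems(1) nn] esym_nonneg_uptoD[OF nn, of m] by simp
  show ?case
  proof (rule esym_pos_uptoI[OF Suc.prems(1)])
    show "esym j S f > 0" if "j \<le> Suc m" for j
      using esym_pos_uptoD[OF *, of j] Suc.prems(3) that by (cases "j = Suc m") auto
    fix i n assume i: "i \<in> S" and n: "Suc m = Suc n"
    have nn': "esym_nonneg_upto m (S - {i}) f"
      by (rule esym_nonneg_upto_remove[OF Suc.prems(1) i Suc.prems(2)])
    have fin: "finite (S - {i})" using Suc.prems(1) by simp
    have "esym m (S - {i}) f \<noteq> 0"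
    proof
      assume 0: "esym m (S - {i}) f = 0"
      then have "real (Suc m) * esym (Suc m) (S - {i}) f \<le> 0"
        using esym_Suc_le[OF fin nn'] by simp
      then have "esym (Suc m) (S - {i}) f \<le> 0" by (simp add: mult_le_0_iff)
      then show False
        using 0 Suc.prems(3) esym_Suc_remove[OF Suc.prems(1) i, of m f] by simp
    qed
    then show "esym_pos_upto n (S - {i}) f"
      using Suc.IH[OF fin nn'] esym_nonneg_uptoD[OF nn', of m] n by simp
  qed
qed

section \<open>The network energy and its minimum\<close>

text \<open>
  \<open>net m S x w\<close> is the energy at the potential \<open>w\<close> of the network realising
  \<open>esym (m + 1) S x / esym m S x\<close> by \<open>esym_ratio\<close>; nodes are the paths from the root \<open>[]\<close>.
\<close>

primrec net :: "nat \<Rightarrow> 'a set \<Rightarrow> ('a \<Rightarrow> real) \<Rightarrow> ('a list \<Rightarrow> real) \<Rightarrow> real" where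
  "net 0 S x w = (\<Sum>i\<in>S. x i) * (w [])\<^sup>2"
| "net (Suc m) S x w =
    (\<Sum>i\<in>S. x i * (w [] - w [i])\<^sup>2 + net m (S - {i}) x (\<lambda>p. w (i # p))) / real (m + 2)"

lemma net_add: "net m S (\<lambda>i. x i + y i) w = net m S x w + net m S y w"
  by (induction m arbitrary: S w)
     (simp_all add: algebra_simps sum.distrib add_divide_distrib)

lemma net_scale: "net m S (\<lambda>i. c * x i) w = c * net m S x w"
proof (induction m arbitrary: S w)
  case 0
  show ?case by (simp add: sum_distrib_left mult.assoc flip: sum_distrib_left)
next
  case (Suc m)
  then show ?case by (simp add: sum_distrib_left distrib_left mult.assoc)
qed

lemma net_shift: "net m S (\<lambda>i. x i + t) w = net m S x w + t * net m S (\<lambda>_. 1) w"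
  using net_add[of m S x "\<lambda>_. t * 1" w] net_scale[of m S t "\<lambda>_. 1" w] by simp

lemma net_zero: "(\<And>p. w p = 0) \<Longrightarrow> net m S x w = 0"
  by (induction m arbitrary: S w) simp_all

text \<open>Completing the square in \<open>u\<close>. Only the sum \<open>a + r\<close> has to be
  positive; the individual conductances may be negative.\<close>

lemma parallel_sum_le:
  fixes a r :: real
  assumes "a + r > 0"
  shows "a * r / (a + r) * z\<^sup>2 \<le> a * (z - u)\<^sup>2 + r * u\<^sup>2"
proof -
  have "((a + r) * u - a * z)\<^sup>2 / (a + r) \<ge> 0" using assms by simp
  moreover have "a * (z - u)\<^sup>2 + r * u\<^sup>2 - a * r / (a + r) * z\<^sup>2 = ((a + r) * u - a * z)\<^sup>2 / (a + r)"
    using assms by (simp add: field_simps power2_eq_square)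
  ultimately show ?thesis by linarith
qed

text \<open>The potential \<open>u = a * z / (a + r)\<close> makes the completed square vanish, so
  the preceding bound is attained.\<close>

lemma parallel_sum_eq:
  fixes a r :: real
  assumes "a + r > 0"
  shows "a * (z - a * z / (a + r))\<^sup>2 + r * (a * z / (a + r))\<^sup>2 = a * r / (a + r) * z\<^sup>2"
proof -
  \<comment> \<open>Expressing \<open>z\<close> as a multiple of \<open>a + r\<close> clears the
    denominators and leaves a polynomial identity.\<close>
  define q where "q = z / (a + r)"
  have z: "z = (a + r) * q" using assms by (simp add: q_def)
  have "a * z / (a + r) = a * q" "a * r / (a + r) * z\<^sup>2 = a * r * ((a + r) * q\<^sup>2)"
    using assms by (simp_all add: z power2_eq_square)
  then have "?thesis \<longleftrightarrow> a * ((a + r) * q - a * q)\<^sup>2 + r * (a * q)\<^sup>2 = a * r * ((a + r) * q\<^sup>2)"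
    by (simp only: z)
  then show ?thesis by (simp add: power2_eq_square algebra_simps)
qed

lemma esym_ratio_pos_upto:
  assumes "finite S" and "esym_pos_upto (Suc m) S x"
  shows "\<And>i. i \<in> S \<Longrightarrow> x i + esym (Suc m) (S - {i}) x / esym m (S - {i}) x > 0"
    and "real (m + 2) * (esym (Suc (Suc m)) S x / esym (Suc m) S x) =
      (\<Sum>i\<in>S. x i * (esym (Suc m) (S - {i}) x / esym m (S - {i}) x) /
        (x i + esym (Suc m) (S - {i}) x / esym m (S - {i}) x))"
proof -
  have pos: "esym m (S - {i}) x > 0" if "i \<in> S" for i
    using esym_pos_upto_remove[OF assms(1) that assms(2)] by (rule esym_pos_uptoD) simp
  have pos': "esym (Suc m) S x > 0" using assms(2) by (rule esym_pos_uptoD) simp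
  show "x i + esym (Suc m) (S - {i}) x / esym m (S - {i}) x > 0" if i: "i \<in> S" for i
  proof -
    have "x i + esym (Suc m) (S - {i}) x / esym m (S - {i}) x = esym (Suc m) S x / esym m (S - {i}) x"
      using pos[OF i] esym_Suc_remove[OF assms(1) i, of m x] by (simp add: field_simps)
    then show ?thesis using pos[OF i] pos' by simp
  qed
  show "real (m + 2) * (esym (Suc (Suc m)) S x / esym (Suc m) S x) =
      (\<Sum>i\<in>S. x i * (esym (Suc m) (S - {i}) x / esym m (S - {i}) x) /
        (x i + esym (Suc m) (S - {i}) x / esym m (S - {i}) x))"
    using esym_ratio[of S m x] assms(1) pos pos' by fastforce
qed

text \<open>In each branch the subnetwork is bounded below by its own ratio at the root potential
  \<open>w [i]\<close>, and \<open>parallel_sum_le\<close> then eliminates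
  \<open>w [i]\<close>.\<close>

lemma net_ge:
  assumes "finite S" and "esym_pos_upto m S x"
  shows "esym (Suc m) S x / esym m S x * (w [])\<^sup>2 \<le> net m S x w"
  using assms
proof (induction m arbitrary: S w)
  case 0
  then show ?case by (simp add: esym_0 esym_1)
next
  case (Suc m)
  let ?R = "\<lambda>i. esym (Suc m) (S - {i}) x / esym m (S - {i}) x"
  note R = esym_ratio_pos_upto[OF Suc.prems]
  have "real (m + 2) * (esym (Suc (Suc m)) S x / esym (Suc m) S x) * (w [])\<^sup>2 =
      (\<Sum>i\<in>S. x i * ?R i / (x i + ?R i) * (w [])\<^sup>2)"
    unfolding R(2) by (rule sum_distrib_right)
  also have "\<dots> \<le> (\<Sum>i\<in>S. x i * (w [] - w [i])\<^sup>2 + net m (S - {i}) x (\<lambda>p. w (i # p)))"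
  proof (rule sum_mono)
    fix i assume i: "i \<in> S"
    have "?R i * (w [i])\<^sup>2 \<le> net m (S - {i}) x (\<lambda>p. w (i # p))"
      using Suc.IH[of "S - {i}" "\<lambda>p. w (i # p)"] esym_pos_upto_remove[OF Suc.prems(1) i Suc.prems(2)]
        Suc.prems(1) by simp
    then show "x i * ?R i / (x i + ?R i) * (w [])\<^sup>2
        \<le> x i * (w [] - w [i])\<^sup>2 + net m (S - {i}) x (\<lambda>p. w (i # p))"
      using parallel_sum_le[OF R(1)[OF i], of "w []" "w [i]"] by linarith
  qed
  finally show ?case by (simp add: field_simps)
qed

text \<open>The bound \<open>net_ge\<close> is attained for every root potential: optimal potentials
  of the branches are glued together.\<close>

lemma net_eq:
  assumes "finite S" and "esym_pos_upto m S x"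
  shows "\<exists>w. w [] = z \<and> net m S x w = esym (Suc m) S x / esym m S x * z\<^sup>2"
  using assms
proof (induction m arbitrary: S z)
  case 0
  then show ?case by (intro exI[of _ "\<lambda>_. z"]) (simp add: esym_0 esym_1)
next
  case (Suc m)
  let ?R = "\<lambda>i. esym (Suc m) (S - {i}) x / esym m (S - {i}) x"
  note R = esym_ratio_pos_upto[OF Suc.prems]
  \<comment> \<open>The minimiser from \<open>parallel_sum_eq\<close>, prescribed as root potential
    of branch \<open>i\<close>.\<close>
  let ?u = "\<lambda>i. x i * z / (x i + ?R i)"
  have "\<exists>w. w [] = ?u i \<and> net m (S - {i}) x w = ?R i * (?u i)\<^sup>2" if "i \<in> S" for i
    using Suc.IH[of "S - {i}"] esym_pos_upto_remove[OF Suc.prems(1) that Suc.prems(2)]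
      Suc.prems(1) by simp
  then obtain v where v: "\<And>i. i \<in> S \<Longrightarrow> v i [] = ?u i \<and> net m (S - {i}) x (v i) = ?R i * (?u i)\<^sup>2"
    by metis
  define w where "w p = (case p of [] \<Rightarrow> z | i # q \<Rightarrow> v i q)" for p
  have "(\<Sum>i\<in>S. x i * (w [] - w [i])\<^sup>2 + net m (S - {i}) x (\<lambda>p. w (i # p))) =
      (\<Sum>i\<in>S. x i * ?R i / (x i + ?R i) * z\<^sup>2)"
  proof (rule sum.cong)
    fix i assume i: "i \<in> S"
    have "x i * (w [] - w [i])\<^sup>2 + net m (S - {i}) x (\<lambda>p. w (i # p)) =
        x i * (z - ?u i)\<^sup>2 + ?R i * (?u i)\<^sup>2"
      using v[OF i] by (simp add: w_def)
    also have "\<dots> = x i * ?R i / (x i + ?R i) * z\<^sup>2"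
      by (rule parallel_sum_eq[OF R(1)[OF i]])
    finally show "x i * (w [] - w [i])\<^sup>2 + net m (S - {i}) x (\<lambda>p. w (i # p)) =
        x i * ?R i / (x i + ?R i) * z\<^sup>2" .
  qed simp
  also have "\<dots> = real (m + 2) * (esym (Suc (Suc m)) S x / esym (Suc m) S x) * z\<^sup>2"
    unfolding R(2) by (rule sum_distrib_right[symmetric])
  finally have "net (Suc m) S x w = real (m + 2) * (esym (Suc (Suc m)) S x / esym (Suc m) S x) * z\<^sup>2 / real (m + 2)"
    by (simp only: net.simps)
  then have "net (Suc m) S x w = esym (Suc (Suc m)) S x / esym (Suc m) S x * z\<^sup>2"
    by simp
  moreover have "w [] = z" by (simp add: w_def)
  ultimately show ?case by blast
qed

section \<open>From nonnegative energy to positivity\<close>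

lemma esym_pos_upto_one:
  assumes "finite S" and "m \<le> card S"
  shows "esym_pos_upto m S (\<lambda>_. 1)"
  unfolding esym_pos_upto_def
proof (intro allI impI)
  fix T j assume T: "T \<subseteq> S \<and> j + card (S - T) \<le> m"
  have fin: "finite T" using T assms(1) finite_subset by blast
  have "card T \<le> card S" using T assms(1) card_mono by blast
  then have "j \<le> card T"
    using T assms(2) card_Diff_subset[OF fin, of S] by auto
  then show "esym j T (\<lambda>_. 1) > (0::real)"
    using fin by (intro esym_pos) auto
qed

text \<open>At the optimal potential for \<open>x + t\<close> with root value 1, the energy plus
  \<open>c\<close> equals the ratio plus \<open>c\<close>. It exceeds the nonnegative value at
  \<open>x\<close> by \<open>t\<close> times the energy with unit conductances, which is positive by
  \<open>net_ge\<close>.\<close>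

lemma net_psd_imp_pos_aux:
  assumes "finite S" and "Suc m \<le> card S"
    and psd: "\<And>w. net m S x w + c * (w [])\<^sup>2 \<ge> 0" and "t > 0"
    and pos: "esym_pos_upto m S (\<lambda>i. x i + t)"
  shows "esym (Suc m) S (\<lambda>i. x i + t) + c * esym m S (\<lambda>i. x i + t) > 0"
proof -
  let ?y = "\<lambda>i. x i + t"
  obtain w where w: "w [] = 1" "net m S ?y w = esym (Suc m) S ?y / esym m S ?y"
    using net_eq[OF assms(1) pos, of 1] by auto
  have one: "esym_pos_upto m S (\<lambda>_. 1)" using assms(1,2) by (intro esym_pos_upto_one) auto
  have "net m S ?y w = net m S x w + t * net m S (\<lambda>_. 1) w"
    by (rule net_shift)
  moreover have "net m S (\<lambda>_. 1) w \<ge> esym (Suc m) S (\<lambda>_. 1) / esym m S (\<lambda>_. 1)"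
    using net_ge[OF assms(1) one, of w] w(1) by simp
  moreover have "esym (Suc m) S (\<lambda>_. 1) / esym m S (\<lambda>_. 1) > (0::real)"
    using assms(1,2) by (intro divide_pos_pos esym_pos) auto
  ultimately have "net m S ?y w = net m S x w + t * net m S (\<lambda>_. 1) w" "net m S (\<lambda>_. 1) w > 0"
    by simp_all
  then have "net m S ?y w + c > 0"
    using psd[of w] w(1) mult_pos_pos[OF \<open>t > 0\<close>, of "net m S (\<lambda>_. 1) w"] by simp
  then have "esym (Suc m) S ?y / esym m S ?y + c > 0" using w(2) by simp
  moreover have "esym m S ?y > 0" using pos by (rule esym_pos_uptoD) simp
  ultimately show ?thesis by (simp add: field_simps)
qed

text \<open>Potentials supported on branch \<open>i\<close> yield the same hypothesis for
  \<open>S - {i}\<close> with \<open>x i\<close> in place of \<open>c\<close>; this is why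
  \<open>c\<close> varies in the induction.\<close>

lemma net_psd_imp_pos:
  assumes "finite S" and "Suc m \<le> card S"
    and "\<And>w. net m S x w + c * (w [])\<^sup>2 \<ge> 0" and "t > 0"
  shows "esym_pos_upto m S (\<lambda>i. x i + t) \<and>
    esym (Suc m) S (\<lambda>i. x i + t) + c * esym m S (\<lambda>i. x i + t) > 0"
  using assms
proof (induction m arbitrary: S c)
  case 0
  have "esym_pos_upto 0 S (\<lambda>i. x i + t)"
    by (rule esym_pos_uptoI) (use 0 in \<open>auto simp: esym_0\<close>)
  then show ?case using net_psd_imp_pos_aux[of S 0 x c t] 0 by blast
next
  case (Suc m)
  let ?y = "\<lambda>i. x i + t"
  have IH: "esym_pos_upto m (S - {i}) ?y \<and> esym (Suc m) (S - {i}) ?y + x i * esym m (S - {i}) ?y > 0"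
    if i: "i \<in> S" for i
  proof (rule Suc.IH)
    show "finite (S - {i})" "Suc m \<le> card (S - {i})" "t > 0"
      using Suc.prems i by (auto simp: card_Diff_singleton)
    fix w :: "'a list \<Rightarrow> real"
    \<comment> \<open>With value 0 at the root and on all other branches, the edge \<open>i\<close>
      contributes \<open>x i\<close> times the square of the potential at the root of its
      branch.\<close>
    define w' where "w' p = (case p of [] \<Rightarrow> 0 | j # q \<Rightarrow> if j = i then w q else 0)" for p
    have "net (Suc m) S x w' + c * (w' [])\<^sup>2 =
        (\<Sum>j\<in>S. if j = i then x i * (w [])\<^sup>2 + net m (S - {i}) x w else 0) / real (m + 2)"
      by (auto simp: w'_def net_zero intro!: sum.cong arg_cong2[where f = "(/)"])
    then have "0 \<le> (x i * (w [])\<^sup>2 + net m (S - {i}) x w) / real (m + 2)"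
      using Suc.prems(3)[of w'] Suc.prems(1) i by simp
    then show "net m (S - {i}) x w + x i * (w [])\<^sup>2 \<ge> 0"
      by (simp add: zero_le_divide_iff add.commute)
  qed
  have ne: "S \<noteq> {}" using Suc.prems by auto
  have "esym (Suc m) S ?y > 0"
  proof -
    obtain i where i: "i \<in> S" using ne by blast
    have "esym m (S - {i}) ?y > 0" using IH[OF i] by (auto intro: esym_pos_uptoD)
    \<comment> \<open>The induction hypothesis has the factor \<open>x i\<close>, the deletion
      identity has \<open>x i + t\<close>; this term is the difference.\<close>
    then have "t * esym m (S - {i}) ?y > 0" using \<open>t > 0\<close> by simp
    then show ?thesis
      using IH[OF i] esym_Suc_remove[OF Suc.prems(1) i, of m ?y] by (simp add: algebra_simps)
  qed
  moreover have "esym j S ?y > 0" if j: "j \<le> m" for j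
  proof -
    \<comment> \<open>Lower orders follow by summing over all deletions, as
      \<open>j < card S\<close>.\<close>
    have "(\<Sum>i\<in>S. esym j (S - {i}) ?y) > 0"
      using Suc.prems(1) ne IH j by (intro sum_pos) (auto intro: esym_pos_uptoD)
    then have "(real (card S) - real j) * esym j S ?y > 0"
      using sum_esym_remove[OF Suc.prems(1), of j ?y] by (simp add: algebra_simps)
    then show ?thesis using j Suc.prems(2) by (simp add: zero_less_mult_iff)
  qed
  ultimately have "esym j S ?y > 0" if "j \<le> Suc m" for j
    using that by (auto simp: le_Suc_eq)
  then have "esym_pos_upto (Suc m) S ?y"
    by (rule esym_pos_uptoI[OF Suc.prems(1)]) (use IH in auto)
  then show ?case using net_psd_imp_pos_aux[of S "Suc m" x c t] Suc.prems by blast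
qed


subsection \<open>Spectrahedra from quadratic forms\<close>

text \<open>The index type may be infinite, as it is for the nodes of the network. A finite list of
  terms records that only finitely many indices occur and makes closure under sums
  immediate.\<close>

definition linear_quadratic_form :: "(real ^ 'n :: finite \<Rightarrow> ('a \<Rightarrow> real) \<Rightarrow> real) \<Rightarrow> bool" where
  "linear_quadratic_form q \<longleftrightarrow>
     (\<exists>ts. (\<forall>(g, a, b) \<in> set ts. linear g) \<and>
        (\<forall>x w. q x w = (\<Sum>(g, a, b) \<leftarrow> ts. g x * w a * w b)))"

lemma linear_quadratic_form_single:
  "linear g \<Longrightarrow> linear_quadratic_form (\<lambda>x w. g x * w a * w b)"
  unfolding linear_quadratic_form_def by (rule exI[of _ "[(g, a, b)]"]) simp

lemma linear_quadratic_form_zero: "linear_quadratic_form (\<lambda>x w. 0)"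
  unfolding linear_quadratic_form_def by (rule exI[of _ "[]"]) simp

lemma linear_quadratic_form_add:
  assumes "linear_quadratic_form q" and "linear_quadratic_form r"
  shows "linear_quadratic_form (\<lambda>x w. q x w + r x w)"
proof -
  obtain ts us where "\<forall>(g, a, b) \<in> set ts. linear g" "\<And>x w. q x w = (\<Sum>(g, a, b) \<leftarrow> ts. g x * w a * w b)"
    "\<forall>(g, a, b) \<in> set us. linear g" "\<And>x w. r x w = (\<Sum>(g, a, b) \<leftarrow> us. g x * w a * w b)"
    using assms unfolding linear_quadratic_form_def by auto
  then show ?thesis
    unfolding linear_quadratic_form_def by (intro exI[of _ "ts @ us"]) auto
qed

lemma linear_quadratic_form_scale:
  assumes "linear_quadratic_form q"
  shows "linear_quadratic_form (\<lambda>x w. c * q x w)"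
proof -
  obtain ts where ts: "\<forall>(g, a, b) \<in> set ts. linear g" "\<And>x w. q x w = (\<Sum>(g, a, b) \<leftarrow> ts. g x * w a * w b)"
    using assms unfolding linear_quadratic_form_def by auto
  let ?us = "map (\<lambda>(g, a, b). (\<lambda>x. c * g x, a, b)) ts"
  have "\<forall>(g, a, b) \<in> set ?us. linear g"
    using ts(1) linear_compose_scale_right[of _ c] by fastforce
  moreover have "c * q x w = (\<Sum>(g, a, b) \<leftarrow> ?us. g x * w a * w b)" for x w
    unfolding ts(2)
    by (simp add: sum_list_const_mult[symmetric] comp_def case_prod_unfold mult.assoc)
  ultimately show ?thesis unfolding linear_quadratic_form_def by blast
qed

lemma linear_quadratic_form_comp:
  assumes "linear_quadratic_form q"
  shows "linear_quadratic_form (\<lambda>x w. q x (\<lambda>p. w (h p)))"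
proof -
  obtain ts where ts: "\<forall>(g, a, b) \<in> set ts. linear g" "\<And>x w. q x w = (\<Sum>(g, a, b) \<leftarrow> ts. g x * w a * w b)"
    using assms unfolding linear_quadratic_form_def by auto
  let ?us = "map (\<lambda>(g, a, b). (g, h a, h b)) ts"
  have "\<forall>(g, a, b) \<in> set ?us. linear g"
    using ts(1) by auto
  moreover have "q x (\<lambda>p. w (h p)) = (\<Sum>(g, a, b) \<leftarrow> ?us. g x * w a * w b)" for x w
    unfolding ts(2) by (simp add: comp_def case_prod_unfold)
  ultimately show ?thesis unfolding linear_quadratic_form_def by blast
qed

lemma linear_quadratic_form_sum:
  assumes "finite I" and "\<And>i. i \<in> I \<Longrightarrow> linear_quadratic_form (q i)"
  shows "linear_quadratic_form (\<lambda>x w. \<Sum>i\<in>I. q i x w)"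
  using assms
  by (induction I rule: finite_induct)
     (auto intro: linear_quadratic_form_zero linear_quadratic_form_add)

lemma linear_nth: "linear (\<lambda>x :: real ^ 'n. x $ i)"
  by (rule linearI) simp_all

lemma linear_quadratic_form_net:
  assumes "finite S"
  shows "linear_quadratic_form (\<lambda>x :: real ^ 'n :: finite. net m S (($) x))"
  using assms
proof (induction m arbitrary: S)
  case 0
  have "linear_quadratic_form (\<lambda>(x :: real ^ 'n) w. \<Sum>i\<in>S. x $ i * w [] * w [])"
    using 0 by (intro linear_quadratic_form_sum linear_quadratic_form_single linear_nth)
  then show ?case by (simp add: power2_eq_square sum_distrib_right mult.assoc)
next
  case (Suc m)
  have sq: "linear_quadratic_form (\<lambda>(x :: real ^ 'n) w. x $ i * (w a - w b)\<^sup>2)" for i a b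
  proof -
    have "linear_quadratic_form (\<lambda>(x :: real ^ 'n) w.
        (x $ i * w a * w a + x $ i * w b * w b) + (- 2) * (x $ i * w a * w b))"
      by (intro linear_quadratic_form_add linear_quadratic_form_scale
          linear_quadratic_form_single linear_nth)
    then show ?thesis by (simp add: power2_eq_square algebra_simps)
  qed
  have sub: "linear_quadratic_form (\<lambda>(x :: real ^ 'n) w. net m (S - {i}) (($) x) (\<lambda>p. w (i # p)))" for i
    by (rule linear_quadratic_form_comp[of "\<lambda>x. net m (S - {i}) (($) x)"]) (use Suc in auto)
  have "linear_quadratic_form (\<lambda>(x :: real ^ 'n) w. 1 / real (m + 2) *
      (\<Sum>i\<in>S. x $ i * (w [] - w [i])\<^sup>2 + net m (S - {i}) (($) x) (\<lambda>p. w (i # p))))"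
    by (rule linear_quadratic_form_scale, rule linear_quadratic_form_sum[OF Suc.prems],
        rule linear_quadratic_form_add[OF sq sub])
  then show ?case by simp
qed

lemma linear_eq_sum_axis:
  fixes g :: "real ^ 'n :: finite \<Rightarrow> real"
  assumes "linear g"
  shows "g x = (\<Sum>i\<in>UNIV. x $ i * g (axis i 1))"
proof -
  have "g x = g (\<Sum>i\<in>UNIV. (x $ i) *\<^sub>R axis i 1)"
    by (simp add: basis_expansion flip: scalar_mult_eq_scaleR)
  also have "\<dots> = (\<Sum>i\<in>UNIV. x $ i * g (axis i 1))"
    using assms by (simp add: linear_sum linear_cmul)
  finally show ?thesis .
qed

text \<open>The indices that occur are numbered, each product \<open>w a * w b\<close> is given its
  symmetric matrix, and the coefficients are expanded in the standard basis.\<close>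

lemma spectrahedral_linear_quadratic_form:
  fixes q :: "real ^ 'n :: finite \<Rightarrow> ('a \<Rightarrow> real) \<Rightarrow> real"
  assumes "linear_quadratic_form q"
  shows "spectrahedral {x. \<forall>w. q x w \<ge> 0}"
proof -
  obtain ts where ts: "\<forall>(g, a, b) \<in> set ts. linear g"
    and q_ts: "\<And>x w. q x w = (\<Sum>(g, a, b) \<leftarrow> ts. g x * w a * w b)"
    using assms unfolding linear_quadratic_form_def by auto
  define n where "n = length ts"
  define g where "g k = fst (ts ! k)" for k
  define a where "a k = fst (snd (ts ! k))" for k
  define b where "b k = snd (snd (ts ! k))" for k
  have lin: "linear (g k)" if "k < n" for k
    using ts nth_mem[of k ts] that by (auto simp: n_def g_def case_prod_unfold)
  have q: "q x w = (\<Sum>k<n. g k x * w (a k) * w (b k))" for x w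
    by (simp add: q_ts sum_list_sum_nth n_def g_def a_def b_def case_prod_unfold atLeast0LessThan)
  define V where "V = a ` {..<n} \<union> b ` {..<n}"
  have "finite V" by (auto simp: V_def)
  then obtain h where h: "bij_betw h {0..<card V} V"
    using ex_bij_betw_nat_finite by blast
  let ?m = "card V"
  \<comment> \<open>The symmetric matrix of the form \<open>w (a k) * w (b k)\<close>; the division
    by 2 also fits the case \<open>a k = b k\<close>.\<close>
  define D where "D k r c = (of_bool (h r = a k) * of_bool (h c = b k) +
    of_bool (h r = b k) * of_bool (h c = a k)) / (2::real)" for k r c
  define B where "B i r c = (\<Sum>k<n. g k (axis i 1) * D k r c)" for i :: 'n and r c
  define A where "A i = mat ?m ?m (\<lambda>(r, c). B i r c)" for i
  have Bsym: "B i r c = B i c r" for i r c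
    unfolding B_def D_def by (simp add: mult.commute add.commute)
  have pick: "(\<Sum>r\<in>{0..<?m}. of_bool (h r = a) * w (h r)) = w a" if "a \<in> V" for a and w :: "'a \<Rightarrow> real"
  proof -
    have "(\<Sum>r\<in>{0..<?m}. of_bool (h r = a) * w (h r)) = (\<Sum>v\<in>V. of_bool (v = a) * w v)"
      by (rule sum.reindex_bij_betw[OF h])
    also have "\<dots> = w a"
      using \<open>finite V\<close> that by (simp add: of_bool_def if_distrib[of "\<lambda>c. c * _"] cong: if_cong)
    finally show ?thesis .
  qed
  have coef: "(\<Sum>i\<in>UNIV. x $ i * B i r c) = (\<Sum>k<n. g k x * D k r c)" for x r c
  proof -
    have gx: "g k x = (\<Sum>i\<in>UNIV. x $ i * g k (axis i 1))" if "k < n" for k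
      by (rule linear_eq_sum_axis[OF lin[OF that]])
    have "(\<Sum>i\<in>UNIV. x $ i * B i r c) = (\<Sum>i\<in>UNIV. \<Sum>k<n. x $ i * g k (axis i 1) * D k r c)"
      by (simp add: B_def sum_distrib_left mult.assoc)
    also have "\<dots> = (\<Sum>k<n. \<Sum>i\<in>UNIV. x $ i * g k (axis i 1) * D k r c)"
      by (rule sum.swap)
    also have "\<dots> = (\<Sum>k<n. g k x * D k r c)"
      by (intro sum.cong refl) (simp add: gx sum_distrib_right)
    finally show ?thesis .
  qed
  have pair: "(\<Sum>r\<in>{0..<?m}. \<Sum>c\<in>{0..<?m}. w (h r) * D k r c * w (h c)) = w (a k) * w (b k)"
    if k: "k < n" for k and w :: "'a \<Rightarrow> real"
  proof -
    let ?s = "\<lambda>v. \<Sum>r\<in>{0..<?m}. of_bool (h r = v) * w (h r)"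
    have s: "?s (a k) = w (a k)" "?s (b k) = w (b k)"
      by (rule pick; use k in \<open>auto simp: V_def\<close>)+
    have "w (a k) * w (b k) = (?s (a k) * ?s (b k) + ?s (b k) * ?s (a k)) / 2"
      unfolding s by simp
    also have "\<dots> = (\<Sum>r\<in>{0..<?m}. \<Sum>c\<in>{0..<?m}.
        (of_bool (h r = a k) * w (h r) * (of_bool (h c = b k) * w (h c)) +
         of_bool (h r = b k) * w (h r) * (of_bool (h c = a k) * w (h c))) / 2)"
      by (simp only: sum_product sum.distrib sum_divide_distrib add_divide_distrib)
    also have "\<dots> = (\<Sum>r\<in>{0..<?m}. \<Sum>c\<in>{0..<?m}. w (h r) * D k r c * w (h c))"
      by (intro sum.cong refl) (simp add: D_def algebra_simps)
    finally show ?thesis by simp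
  qed
  have form: "(\<Sum>r\<in>{0..<?m}. w (h r) * (\<Sum>c\<in>{0..<?m}. (\<Sum>i\<in>UNIV. x $ i * B i r c) * w (h c))) = q x w"
    for x w
  proof -
    let ?F = "\<lambda>k r c. g k x * (w (h r) * D k r c * w (h c))"
    have "(\<Sum>r\<in>{0..<?m}. w (h r) * (\<Sum>c\<in>{0..<?m}. (\<Sum>i\<in>UNIV. x $ i * B i r c) * w (h c))) =
      (\<Sum>r\<in>{0..<?m}. \<Sum>c\<in>{0..<?m}. \<Sum>k<n. ?F k r c)"
      by (simp add: coef sum_distrib_left sum_distrib_right mult_ac)
    also have "\<dots> = (\<Sum>r\<in>{0..<?m}. \<Sum>k<n. \<Sum>c\<in>{0..<?m}. ?F k r c)"
      by (intro sum.cong refl sum.swap)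
    also have "\<dots> = (\<Sum>k<n. \<Sum>r\<in>{0..<?m}. \<Sum>c\<in>{0..<?m}. ?F k r c)"
      by (rule sum.swap)
    also have "\<dots> = (\<Sum>k<n. g k x * (w (a k) * w (b k)))"
      by (intro sum.cong refl) (simp add: pair flip: sum_distrib_left)
    finally show ?thesis by (simp add: q mult.assoc)
  qed
  have pencil: "mat_pencil ?m A x = mat ?m ?m (\<lambda>(r, c). \<Sum>i\<in>UNIV. x $ i * B i r c)" for x
    unfolding mat_pencil_def by (rule eq_matI) (auto simp: A_def)
  have quad: "scalar_prod v (mat_pencil ?m A x *\<^sub>v v) =
      (\<Sum>r\<in>{0..<?m}. vec_index v r * (\<Sum>c\<in>{0..<?m}. (\<Sum>i\<in>UNIV. x $ i * B i r c) * vec_index v c))"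
    if "v \<in> carrier_vec ?m" for v x
    using that unfolding pencil by (auto simp: scalar_prod_def row_def intro!: sum.cong)
  have "psd_mat (mat_pencil ?m A x) \<longleftrightarrow> (\<forall>w. q x w \<ge> 0)" for x
  proof
    assume psd: "psd_mat (mat_pencil ?m A x)"
    show "\<forall>w. q x w \<ge> 0"
    proof
      fix w :: "'a \<Rightarrow> real"
      let ?v = "vec ?m (\<lambda>r. w (h r))"
      have "scalar_prod ?v (mat_pencil ?m A x *\<^sub>v ?v) = q x w"
        by (subst quad) (auto simp flip: form[of w x])
      moreover have "dim_row (mat_pencil ?m A x) = ?m" by (simp add: mat_pencil_def)
      ultimately show "q x w \<ge> 0"
        using psd unfolding psd_mat_def by (metis vec_carrier)
    qed
  next
    assume nn: "\<forall>w. q x w \<ge> 0"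
    have "transpose_mat (mat_pencil ?m A x) = mat_pencil ?m A x"
      unfolding pencil by (rule eq_matI) (auto simp: Bsym)
    moreover have "scalar_prod v (mat_pencil ?m A x *\<^sub>v v) \<ge> 0" if v: "v \<in> carrier_vec ?m" for v
    proof -
      \<comment> \<open>The vector is transported to the indices in \<open>V\<close> through the
        inverse of \<open>h\<close>; \<open>q\<close> reads potentials only there.\<close>
      define w where "w a = vec_index v (inv_into {0..<?m} h a)" for a
      have "w (h r) = vec_index v r" if "r \<in> {0..<?m}" for r
        using bij_betw_inv_into_left[OF h that] by (simp add: w_def)
      then have "scalar_prod v (mat_pencil ?m A x *\<^sub>v v) = q x w"
        unfolding quad[OF v] form[of w x, symmetric] by (intro sum.cong) auto
      then show ?thesis using nn by simp
    qed
    ultimately show "psd_mat (mat_pencil ?m A x)"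
      by (auto simp: psd_mat_def symmetric_mat_def mat_pencil_def)
  qed
  moreover have "A i \<in> carrier_mat ?m ?m \<and> symmetric_mat (A i)" for i
    unfolding symmetric_mat_def A_def by (auto simp: Bsym intro!: eq_matI)
  ultimately show ?thesis
    unfolding spectrahedral_def by blast
qed


subsection \<open>Substitution into polynomials\<close>

text \<open>Cancellation may shrink the keys of a sum, so a common finite set of exponents is
  needed; the added terms vanish because \<open>c 0 = 0\<close>.\<close>

lemma mpoly_subst_superset:
  assumes "c 0 = 0" and "finite K" and "Poly_Mapping.keys p \<subseteq> K"
  shows "mpoly_subst c a p =
    (\<Sum>m\<in>K. c (Poly_Mapping.lookup p m) * (\<Prod>i\<in>UNIV. a i ^ Poly_Mapping.lookup m i))"
  unfolding mpoly_subst_def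
  by (rule sum.mono_neutral_left) (use assms in \<open>auto simp: in_keys_iff\<close>)

lemma poly_mapping_eq_sum_single:
  "p = (\<Sum>m\<in>Poly_Mapping.keys p. Poly_Mapping.single m (Poly_Mapping.lookup p m))"
  by (rule poly_mapping_eqI)
     (auto simp: lookup_sum lookup_single when_def in_keys_iff)

text \<open>Treats the real evaluation and the complex evaluation on a line at once.\<close>

locale coefficient_hom =
  fixes c :: "real \<Rightarrow> 'b :: comm_ring_1"
  assumes add: "c (x + y) = c x + c y" and mult: "c (x * y) = c x * c y" and one: "c 1 = 1"
begin

lemma zero: "c 0 = 0"
  using add[of 0 0] by simp

lemma subst_add: "mpoly_subst c a (p + q) = mpoly_subst c a p + mpoly_subst c a q"
proof -
  let ?K = "Poly_Mapping.keys p \<union> Poly_Mapping.keys q"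
  have "Poly_Mapping.keys (p + q) \<subseteq> ?K" by (rule keys_add)
  then show ?thesis
    by (simp add: mpoly_subst_superset[of c ?K, OF zero] lookup_add add distrib_right sum.distrib)
qed

lemma subst_zero: "mpoly_subst c a 0 = 0"
  by (simp add: mpoly_subst_def)

lemma subst_sum: "mpoly_subst c a (\<Sum>i\<in>I. p i) = (\<Sum>i\<in>I. mpoly_subst c a (p i))"
  by (induction I rule: infinite_finite_induct) (simp_all add: subst_zero subst_add)

lemma subst_single:
  "mpoly_subst c a (Poly_Mapping.single m r) = c r * (\<Prod>i\<in>UNIV. a i ^ Poly_Mapping.lookup m i)"
  by (subst mpoly_subst_superset[of c "{m}", OF zero]) auto

lemma subst_mult: "mpoly_subst c a (p * q) = mpoly_subst c a p * mpoly_subst c a q"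
proof -
  have "p * q = (\<Sum>m\<in>Poly_Mapping.keys p. \<Sum>n\<in>Poly_Mapping.keys q.
      Poly_Mapping.single (m + n) (Poly_Mapping.lookup p m * Poly_Mapping.lookup q n))"
    by (subst poly_mapping_eq_sum_single[of p], subst poly_mapping_eq_sum_single[of q])
       (simp add: sum_product mult_single)
  then have "mpoly_subst c a (p * q) = (\<Sum>m\<in>Poly_Mapping.keys p. \<Sum>n\<in>Poly_Mapping.keys q.
      c (Poly_Mapping.lookup p m * Poly_Mapping.lookup q n) *
      (\<Prod>i\<in>UNIV. a i ^ Poly_Mapping.lookup (m + n) i))"
    by (simp add: subst_sum subst_single)
  also have "\<dots> = mpoly_subst c a p * mpoly_subst c a q"
    unfolding mpoly_subst_def sum_product
    by (intro sum.cong refl) (simp add: mult lookup_add power_add prod.distrib mult_ac)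
  finally show ?thesis .
qed

lemma subst_one: "mpoly_subst c a 1 = 1"
  using subst_single[of a 0 1] by (simp add: one)

lemma subst_prod: "mpoly_subst c a (\<Prod>i\<in>I. p i) = (\<Prod>i\<in>I. mpoly_subst c a (p i))"
  by (induction I rule: infinite_finite_induct) (simp_all add: subst_one subst_mult)

lemma subst_mvar: "mpoly_subst c a (mvar i) = a i"
proof -
  have "(\<Prod>j\<in>UNIV. a j ^ Poly_Mapping.lookup (Poly_Mapping.single i 1) j) = (\<Prod>j\<in>UNIV. if j = i then a j else 1)"
    by (intro prod.cong) (auto simp: lookup_single when_def)
  then show ?thesis unfolding mvar_def subst_single by (simp add: one)
qed

lemma subst_mconst: "mpoly_subst c a (mconst r) = c r"
  unfolding mconst_def subst_single by simp

lemma subst_elem_sym: "mpoly_subst c a (elem_sym k) = esym k UNIV a"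
  by (simp add: elem_sym_def esym_def subst_sum subst_prod subst_mvar)

lemma subst_linear_form:
  "mpoly_subst c a (linear_form l) = (\<Sum>i\<in>UNIV. c (l (axis i 1)) * a i)"
  by (simp add: linear_form_def subst_sum subst_mult subst_mvar subst_mconst)

end

interpretation eval_hom: coefficient_hom "\<lambda>c :: real. c"
  by unfold_locales auto

interpretation complex_hom: coefficient_hom complex_of_real
  by unfold_locales auto

lemma poly_map_poly_of_real_add:
  "poly (map_poly of_real (p + q)) (z :: complex) = poly (map_poly of_real p) z + poly (map_poly of_real q) z"
proof -
  have "map_poly complex_of_real (p + q) = map_poly of_real p + map_poly of_real q"
    by (rule poly_eqI) (simp add: coeff_map_poly)
  then show ?thesis by simp
qed

lemma poly_map_poly_of_real_mult:
  "poly (map_poly of_real (p * q)) (z :: complex) = poly (map_poly of_real p) z * poly (map_poly of_real q) z"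
proof -
  have "map_poly complex_of_real (p * q) = map_poly of_real p * map_poly of_real q"
    by (rule poly_eqI) (simp add: coeff_map_poly coeff_mult)
  then show ?thesis by simp
qed

text \<open>Evaluation at \<open>z\<close> is compatible with sums, products and powers, and sends
  the linear polynomial of coordinate \<open>i\<close> to \<open>x $ i + z * v $ i\<close>.\<close>

lemma poly_line_restriction:
  fixes z :: complex
  shows "poly (map_poly of_real (line_restriction p x v)) z =
    mpoly_subst of_real (\<lambda>i. of_real (x $ i) + z * of_real (v $ i)) p"
proof -
  let ?h = "\<lambda>q. poly (map_poly of_real q) z"
  have sum: "?h (\<Sum>i\<in>I. F i) = (\<Sum>i\<in>I. ?h (F i))" for I :: "'i set" and F
    by (induction I rule: infinite_finite_induct) (simp_all add: poly_map_poly_of_real_add)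
  have prod: "?h (\<Prod>i\<in>I. F i) = (\<Prod>i\<in>I. ?h (F i))" for I :: "'i set" and F
    by (induction I rule: infinite_finite_induct) (simp_all add: poly_map_poly_of_real_mult)
  have power: "?h (q ^ n) = ?h q ^ n" for q n
    by (induction n) (simp_all add: poly_map_poly_of_real_mult)
  show ?thesis
    unfolding line_restriction_def mpoly_subst_def sum poly_map_poly_of_real_mult prod power
    by (simp add: map_poly_pCons)
qed


subsection \<open>Homogeneity\<close>

text \<open>The degree is explicit because a sum is homogeneous only if the degrees of its terms
  agree.\<close>

definition homogeneous_of :: "nat \<Rightarrow> 'n :: finite real_mpoly \<Rightarrow> bool" where
  "homogeneous_of d p \<longleftrightarrow> (\<forall>m\<in>Poly_Mapping.keys p. (\<Sum>i\<in>UNIV. Poly_Mapping.lookup m i) = d)"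

lemma homogeneous_of_add:
  "homogeneous_of d p \<Longrightarrow> homogeneous_of d q \<Longrightarrow> homogeneous_of d (p + q)"
  using keys_add[of p q] unfolding homogeneous_of_def by blast

lemma homogeneous_of_sum:
  "(\<And>i. i \<in> I \<Longrightarrow> homogeneous_of d (p i)) \<Longrightarrow> homogeneous_of d (\<Sum>i\<in>I. p i)"
  by (induction I rule: infinite_finite_induct)
     (auto intro: homogeneous_of_add, auto simp: homogeneous_of_def)

lemma homogeneous_of_mult:
  assumes "homogeneous_of d p" and "homogeneous_of e q"
  shows "homogeneous_of (d + e) (p * q)"
  unfolding homogeneous_of_def
proof
  fix m assume "m \<in> Poly_Mapping.keys (p * q)"
  then obtain a b where "m = a + b" "a \<in> Poly_Mapping.keys p" "b \<in> Poly_Mapping.keys q"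
    using keys_mult[of p q] by blast
  then show "(\<Sum>i\<in>UNIV. Poly_Mapping.lookup m i) = d + e"
    using assms by (simp add: homogeneous_of_def lookup_add sum.distrib)
qed

lemma homogeneous_of_mconst: "homogeneous_of 0 (mconst r)"
  by (auto simp: homogeneous_of_def mconst_def)

lemma homogeneous_of_mvar: "homogeneous_of 1 (mvar i)"
  by (auto simp: homogeneous_of_def mvar_def lookup_single when_def)

lemma homogeneous_of_prod_mvar: "finite S \<Longrightarrow> homogeneous_of (card S) (\<Prod>i\<in>S. mvar i)"
proof (induction S rule: finite_induct)
  case empty
  show ?case using homogeneous_of_mconst[of 1] by (simp add: mconst_def)
next
  case (insert i S)
  then show ?case using homogeneous_of_mult[OF homogeneous_of_mvar insert.IH] by simp
qed

lemma homogeneous_of_elem_sym: "homogeneous_of k (elem_sym k)"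
  unfolding elem_sym_def
  by (rule homogeneous_of_sum) (use homogeneous_of_prod_mvar in \<open>auto intro: finite\<close>)

lemma homogeneous_of_linear_form: "homogeneous_of 1 (linear_form l)"
  unfolding linear_form_def
  using homogeneous_of_mult[OF homogeneous_of_mconst homogeneous_of_mvar]
  by (intro homogeneous_of_sum) simp


subsection \<open>The hyperbolicity cone\<close>

lemma tendsto_esym:
  fixes f :: "'s \<Rightarrow> 'a \<Rightarrow> real"
  assumes "\<And>i. ((\<lambda>s. f s i) \<longlongrightarrow> g i) F"
  shows "((\<lambda>s. esym k S (f s)) \<longlongrightarrow> esym k S g) F"
  unfolding esym_def by (intro tendsto_sum tendsto_prod assms)

text \<open>Only finitely many pairs \<open>(T, j)\<close> are constrained, so positivity is an open
  condition.\<close>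

lemma eventually_esym_pos_upto:
  assumes "finite S" and "esym_pos_upto m S g" and "\<And>i. ((\<lambda>s. f s i) \<longlongrightarrow> g i) F"
  shows "eventually (\<lambda>s. esym_pos_upto m S (f s)) F"
proof -
  let ?K = "{(T, j). T \<subseteq> S \<and> j + card (S - T) \<le> m}"
  have "?K \<subseteq> Pow S \<times> {..m}" by auto
  then have fin: "finite ?K"
    by (rule finite_subset) (use assms(1) in auto)
  have "\<forall>(T, j) \<in> ?K. eventually (\<lambda>s. esym j T (f s) > 0) F"
    using assms(2) unfolding esym_pos_upto_def
    by (auto intro!: order_tendstoD(1)[OF tendsto_esym[OF assms(3)]])
  then have "eventually (\<lambda>s. \<forall>(T, j) \<in> ?K. esym j T (f s) > 0) F"
    using eventually_ball_finite[OF fin, of "\<lambda>s Tj. esym (snd Tj) (fst Tj) (f s) > 0" F]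
    by (auto simp: case_prod_unfold)
  then show ?thesis
    by (rule eventually_mono) (auto simp: esym_pos_upto_def)
qed

lemma esym_nonneg_upto_limit:
  assumes "\<And>n. esym_pos_upto m S (f n)" and "\<And>i. (\<lambda>n. f n i) \<longlonglongrightarrow> g i"
  shows "esym_nonneg_upto m S g"
  unfolding esym_nonneg_upto_def
proof (intro allI impI)
  fix T j assume "T \<subseteq> S \<and> j + card (S - T) \<le> m"
  then have "esym j T (f n) > 0" for n
    using assms(1) unfolding esym_pos_upto_def by blast
  then show "esym j T g \<ge> 0"
    by (intro LIMSEQ_le_const[OF tendsto_esym[OF assms(2)]]) (auto intro: less_imp_le)
qed

lemma esym_pos_upto_scale:
  assumes "esym_pos_upto m S f" and "c > 0"
  shows "esym_pos_upto m S (\<lambda>i. c * f i)"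
  using assms by (simp add: esym_pos_upto_def esym_scale)

section \<open>The cone compared with nonnegativity of the energy, for
  \<open>k = Suc m\<close>\<close>

context
  fixes l :: "real ^ 'n :: finite \<Rightarrow> real" and m :: nat
  assumes lin: "linear l" and l1: "l 1 \<ge> 0" and m: "Suc m \<le> CARD('n)"
begin

definition pval :: "real ^ 'n \<Rightarrow> real" where
  "pval x = esym (Suc m) UNIV (($) x) + l x * esym m UNIV (($) x)"

lemma l_shift: "l (x + t *\<^sub>R 1) = l x + t * l 1"
  using lin by (simp add: linear_add linear_cmul)

lemma nth_shift: "($) (x + t *\<^sub>R 1) = (\<lambda>i. x $ i + t)" for x :: "real ^ 'n"
  by (simp add: fun_eq_iff)

lemma pval_scale: "pval (c *\<^sub>R x) = c ^ Suc m * pval x"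
proof -
  have "($) (c *\<^sub>R x) = (\<lambda>i. c * x $ i)" by (simp add: fun_eq_iff)
  then show ?thesis
    using lin by (simp add: pval_def esym_scale linear_cmul algebra_simps)
qed

lemma tendsto_pval_shift:
  assumes "(s \<longlongrightarrow> t) F"
  shows "((\<lambda>n. pval (x + s n *\<^sub>R 1)) \<longlongrightarrow> pval (x + t *\<^sub>R 1)) F"
  unfolding pval_def l_shift nth_shift
  by (intro tendsto_intros tendsto_esym assms)

text \<open>The inclusion of the spectrahedron in the cone. \<open>net_psd_imp_pos\<close> with
  \<open>c = l x\<close> leaves \<open>l\<close> unshifted; the shift adds
  \<open>t * l 1 * e_m\<close>, which is nonnegative.\<close>

lemma pval_shift_pos:
  assumes "\<And>w. net m UNIV (($) x) w + l x * (w [])\<^sup>2 \<ge> 0" and "t > 0"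
  shows "pval (x + t *\<^sub>R 1) > 0"
proof -
  let ?e = "\<lambda>k. esym k UNIV (\<lambda>i. x $ i + t)"
  have *: "esym_pos_upto m UNIV (\<lambda>i. x $ i + t)" "?e (Suc m) + l x * ?e m > 0"
    using net_psd_imp_pos[of "UNIV :: 'n set" m "($) x" "l x" t] assms m by auto
  have "t * l 1 * ?e m \<ge> 0"
    using esym_pos_uptoD[OF *(1), of m] assms(2) l1 by simp
  then show ?thesis
    using *(2) by (simp add: pval_def l_shift nth_shift algebra_simps)
qed

text \<open>By homogeneity \<open>x + t 1\<close> may be replaced by \<open>s x + 1\<close> with
  \<open>s = 1 / t\<close>, which is close to the all-ones vector for large \<open>t\<close>. This
  starts the connectedness argument.\<close>

lemma ex_pos_shift: "\<exists>t>0. pval (x + t *\<^sub>R 1) > 0 \<and> esym_pos_upto m UNIV (\<lambda>i. x $ i + t)"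
proof -
  have one: "($) (1 :: real ^ 'n) = (\<lambda>i. 1)" by (simp add: fun_eq_iff)
  have pval1: "pval 1 > 0"
    unfolding pval_def one using m l1
    by (intro add_pos_nonneg mult_nonneg_nonneg less_imp_le[OF esym_pos] esym_pos) auto
  have nth: "($) (s *\<^sub>R x + 1) = (\<lambda>i. s * x $ i + 1)" for s by (simp add: fun_eq_iff)
  have lsx: "l (s *\<^sub>R x + 1) = s * l x + l 1" for s using lin by (simp add: linear_add linear_cmul)
  have coord: "((\<lambda>s. s * x $ i + 1) \<longlongrightarrow> 1) (at_right 0)" for i
    by (auto intro!: tendsto_eq_intros)
  have lin_lim: "((\<lambda>s. s * l x + l 1) \<longlongrightarrow> l 1) (at_right 0)"
    by (auto intro!: tendsto_eq_intros)
  have "((\<lambda>s. pval (s *\<^sub>R x + 1)) \<longlongrightarrow> pval 1) (at_right 0)"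
    unfolding pval_def nth lsx one
    by (intro tendsto_add tendsto_mult lin_lim tendsto_esym coord)
  then have "eventually (\<lambda>s. pval (s *\<^sub>R x + 1) > 0) (at_right 0)"
    using pval1 by (rule order_tendstoD)
  moreover have "eventually (\<lambda>s. esym_pos_upto m UNIV (\<lambda>i. s * x $ i + 1)) (at_right 0)"
    by (rule eventually_esym_pos_upto[OF _ esym_pos_upto_one coord]) (use m in auto)
  moreover have "eventually (\<lambda>s :: real. s > 0) (at_right 0)" by (rule eventually_at_right_less)
  ultimately have "eventually (\<lambda>s. s > 0 \<and> pval (s *\<^sub>R x + 1) > 0 \<and>
      esym_pos_upto m UNIV (\<lambda>i. s * x $ i + 1)) (at_right 0)"
    by eventually_elim simp
  then obtain s where s: "s > 0" "pval (s *\<^sub>R x + 1) > 0" "esym_pos_upto m UNIV (\<lambda>i. s * x $ i + 1)"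
    using eventually_happens[of _ "at_right (0::real)"] by (auto simp: trivial_limit_at_right_real)
  have "x + (1 / s) *\<^sub>R 1 = (1 / s) *\<^sub>R (s *\<^sub>R x + 1)" using s(1) by (simp add: scaleR_add_right)
  then have "pval (x + (1 / s) *\<^sub>R 1) > 0" using s(1,2) by (simp add: pval_scale)
  moreover have "esym_pos_upto m UNIV (\<lambda>i. x $ i + 1 / s)"
    using esym_pos_upto_scale[OF s(3), of "1 / s"] s(1) by (simp add: distrib_left)
  ultimately show ?thesis using s(1) by (intro exI[of _ "1 / s"]) simp
qed

text \<open>
  The positivity conditions define a relatively clopen set of parameters. It is closed because
  \<open>pval \<le> (e\<^sub>1 / (m + 1) + l) e\<^sub>m\<close> on the closure, so \<open>e\<^sub>m\<close> cannot vanish before \<open>pval\<close> does.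
\<close>

lemma esym_pos_upto_shift:
  assumes nz: "\<And>t. t > 0 \<Longrightarrow> pval (x + t *\<^sub>R 1) \<noteq> 0" and "t > 0"
  shows "pval (x + t *\<^sub>R 1) > 0 \<and> esym_pos_upto m UNIV (\<lambda>i. x $ i + t)"
proof -
  define A where "A = {t. t > 0 \<and> pval (x + t *\<^sub>R 1) > 0 \<and> esym_pos_upto m UNIV (\<lambda>i. x $ i + t)}"
  have "open A"
  proof (subst open_subopen, intro ballI)
    fix t assume t: "t \<in> A"
    have id: "((\<lambda>s. s) \<longlongrightarrow> t) (nhds t)" by (rule filterlim_ident)
    have "eventually (\<lambda>s. s > 0) (nhds t)"
      by (rule order_tendstoD(1)[OF id]) (use t in \<open>simp add: A_def\<close>)
    moreover have "eventually (\<lambda>s. pval (x + s *\<^sub>R 1) > 0) (nhds t)"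
      by (rule order_tendstoD(1)[OF tendsto_pval_shift[OF id]]) (use t in \<open>simp add: A_def\<close>)
    moreover have "eventually (\<lambda>s. esym_pos_upto m UNIV (\<lambda>i. x $ i + s)) (nhds t)"
      by (rule eventually_esym_pos_upto[where g = "\<lambda>i. x $ i + t"])
         (use t in \<open>auto simp: A_def intro!: tendsto_intros id\<close>)
    ultimately have "eventually (\<lambda>s. s \<in> A) (nhds t)"
      unfolding A_def by eventually_elim simp
    then show "\<exists>T. open T \<and> t \<in> T \<and> T \<subseteq> A"
      by (auto simp: eventually_nhds)
  qed
  moreover have "{0<..} \<inter> closure A \<subseteq> A"
  proof
    fix t assume "t \<in> {0<..} \<inter> closure A"
    then obtain s where t: "t > 0" and s: "\<And>n. s n \<in> A" and lim: "s \<longlonglongrightarrow> t"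
      by (auto simp: closure_sequential)
    let ?y = "\<lambda>i. x $ i + t"
    have "pval (x + t *\<^sub>R 1) \<ge> 0"
      by (rule LIMSEQ_le_const[OF tendsto_pval_shift[OF lim]])
         (use s in \<open>auto simp: A_def intro: less_imp_le\<close>)
    then have pos: "pval (x + t *\<^sub>R 1) > 0" using nz[OF t] by simp
    have nn: "esym_nonneg_upto m UNIV ?y"
      by (rule esym_nonneg_upto_limit[where f = "\<lambda>n i. x $ i + s n"])
         (use s lim in \<open>auto simp: A_def intro!: tendsto_intros\<close>)
    have "esym m UNIV ?y \<noteq> 0"
    proof
      assume 0: "esym m UNIV ?y = 0"
      then have "real (Suc m) * esym (Suc m) UNIV ?y \<le> 0"
        using esym_Suc_le[OF _ nn] by simp
      then have "esym (Suc m) UNIV ?y \<le> 0" by (simp add: mult_le_0_iff)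
      then show False using pos 0 by (simp add: pval_def nth_shift)
    qed
    then have "esym_pos_upto m UNIV ?y"
      using esym_nonneg_upto_imp_pos[OF _ nn] esym_nonneg_uptoD[OF nn, of m] by simp
    then show "t \<in> A" using t pos by (simp add: A_def)
  qed
  then have "A = {0<..} \<inter> closure A"
    using closure_subset[of A] by (auto simp: A_def)
  then have "closedin (top_of_set {0<..}) A"
    using closedin_closed by blast
  moreover have "openin (top_of_set {0<..}) A"
    using \<open>open A\<close> by (auto simp: A_def openin_open intro!: exI[of _ A])
  moreover have "A \<noteq> {}" using ex_pos_shift[of x] by (auto simp: A_def)
  moreover have "connected {0::real<..}" by (rule convex_connected) simp
  ultimately have "A = {0<..}" using connected_clopen by blast
  then show ?thesis using assms(2) by (auto simp: A_def)
qed

text \<open>The inclusion of the cone in the spectrahedron. For \<open>t > 0\<close> the form at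
  \<open>x + t 1\<close> is nonnegative by \<open>net_ge\<close>; it is affine in \<open>t\<close>,
  so \<open>t\<close> may tend to 0.\<close>

lemma net_psd:
  assumes "\<And>t. t > 0 \<Longrightarrow> pval (x + t *\<^sub>R 1) \<noteq> 0"
  shows "net m UNIV (($) x) w + l x * (w [])\<^sup>2 \<ge> 0"
proof -
  let ?a = "net m UNIV (($) x) w + l x * (w [])\<^sup>2"
  let ?b = "net m UNIV (\<lambda>_. 1) w + l 1 * (w [])\<^sup>2"
  have ge: "?a + t * ?b \<ge> 0" if t: "t > 0" for t
  proof -
    let ?e = "\<lambda>k. esym k UNIV (\<lambda>i. x $ i + t)"
    have *: "pval (x + t *\<^sub>R 1) > 0" "esym_pos_upto m UNIV (\<lambda>i. x $ i + t)"
      using esym_pos_upto_shift[OF assms t] by auto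
    have e: "?e m > 0" using *(2) by (rule esym_pos_uptoD) simp
    have "?e (Suc m) / ?e m + l (x + t *\<^sub>R 1) = pval (x + t *\<^sub>R 1) / ?e m"
      using e by (simp add: pval_def nth_shift field_simps)
    then have "(?e (Suc m) / ?e m + l (x + t *\<^sub>R 1)) * (w [])\<^sup>2 \<ge> 0"
      using *(1) e by simp
    then have "net m UNIV (\<lambda>i. x $ i + t) w + l (x + t *\<^sub>R 1) * (w [])\<^sup>2 \<ge> 0"
      using net_ge[OF _ *(2), of w] by (simp add: distrib_right)
    then show ?thesis
      unfolding net_shift l_shift by (simp add: algebra_simps)
  qed
  have "((\<lambda>t. ?a + t * ?b) \<longlongrightarrow> ?a + 0 * ?b) (at_right 0)"
    by (intro tendsto_intros)
  moreover have "eventually (\<lambda>t. ?a + t * ?b \<ge> 0) (at_right 0)"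
    using eventually_at_right_less[of 0] by eventually_elim (rule ge)
  ultimately have "?a + 0 * ?b \<ge> 0"
    by (rule tendsto_lowerbound) (simp add: trivial_limit_at_right_real)
  then show ?thesis by simp
qed

section \<open>Return to polynomials: hyperbolicity and the cone\<close>

lemma mpoly_eval_eq_pval: "mpoly_eval (elem_sym (Suc m) + linear_form l * elem_sym m) x = pval x"
proof -
  have "(\<Sum>i\<in>UNIV. l (axis i 1) * x $ i) = l x"
    using linear_eq_sum_axis[OF lin, of x] by (simp add: mult.commute)
  then show ?thesis
    by (simp add: mpoly_eval_def pval_def eval_hom.subst_add eval_hom.subst_mult
        eval_hom.subst_elem_sym eval_hom.subst_linear_form)
qed

text \<open>For \<open>Im z > 0\<close> the ratio has positive imaginary part and the linear form
  adds \<open>Im z * l 1\<close>, which is nonnegative, so their sum is nonzero. Conjugation covers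
  the lower half plane.\<close>

lemma only_real_roots_line:
  "only_real_roots (line_restriction (elem_sym (Suc m) + linear_form l * elem_sym m) x 1)"
  unfolding only_real_roots_def
proof (intro allI impI)
  fix z
  \<comment> \<open>The coordinates of \<open>x + z 1\<close>; \<open>P\<close> is the polynomial at
    this complex point.\<close>
  define f where "f z i = complex_of_real (x $ i) + z" for z i
  define P where "P z = esym (Suc m) UNIV (f z) + (of_real (l x) + z * of_real (l 1)) * esym m UNIV (f z)" for z
  have line: "poly (map_poly of_real
      (line_restriction (elem_sym (Suc m) + linear_form l * elem_sym m) x 1)) z = P z"
  proof -
    have "(\<Sum>i\<in>UNIV. complex_of_real (l (axis i 1)) * f z i) =
        of_real (\<Sum>i\<in>UNIV. x $ i * l (axis i 1)) + z * of_real (\<Sum>i\<in>UNIV. (1 :: real ^ 'n) $ i * l (axis i 1))"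
      by (simp add: f_def distrib_left sum.distrib sum_distrib_left mult.commute)
    also have "\<dots> = of_real (l x) + z * of_real (l 1)"
      by (simp only: linear_eq_sum_axis[OF lin, symmetric])
    finally show ?thesis
      unfolding poly_line_restriction complex_hom.subst_add complex_hom.subst_mult
        complex_hom.subst_elem_sym complex_hom.subst_linear_form P_def
      by (simp add: f_def[abs_def])
  qed
  have upper: "P z \<noteq> 0" if z: "Im z > 0" for z
  proof
    assume "P z = 0"
    let ?r = "esym (Suc m) UNIV (f z) / esym m UNIV (f z)"
    have r: "esym m UNIV (f z) \<noteq> 0" "Im ?r > 0"
      using esym_upper_half_plane[of "UNIV :: 'n set" "f z" m] z m by (auto simp: f_def)
    have "Im (?r + (of_real (l x) + z * of_real (l 1))) > 0"
      using r(2) z l1 by (simp add: add_pos_nonneg)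
    moreover have "?r + (of_real (l x) + z * of_real (l 1)) = P z / esym m UNIV (f z)"
      using r(1) by (simp add: P_def field_simps)
    ultimately show False using \<open>P z = 0\<close> by simp
  qed
  have cnj: "P (cnj z) = cnj (P z)"
  proof -
    have "f (cnj z) = (\<lambda>i. cnj (f z i))" by (simp add: f_def fun_eq_iff)
    then show ?thesis by (simp add: P_def esym_cnj)
  qed
  assume "poly (map_poly of_real
      (line_restriction (elem_sym (Suc m) + linear_form l * elem_sym m) x 1)) z = 0"
  then have "P z = 0" "P (cnj z) = 0" by (simp_all add: line cnj)
  then have "Im z = 0" using upper[of z] upper[of "cnj z"] by (cases "Im z" "0::real" rule: linorder_cases) auto
  then show "z \<in> \<real>" by (simp add: complex_is_Real_iff)
qed

lemma hyperbolic_elem_sym_plus: "hyperbolic (elem_sym (Suc m) + linear_form l * elem_sym m) 1"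
  unfolding hyperbolic_def
proof (intro conjI allI)
  have "homogeneous_of (Suc m) (linear_form l * elem_sym m)"
    using homogeneous_of_mult[OF homogeneous_of_linear_form homogeneous_of_elem_sym] by simp
  then have "homogeneous_of (Suc m) (elem_sym (Suc m) + linear_form l * elem_sym m)"
    by (intro homogeneous_of_add homogeneous_of_elem_sym)
  then show "homogeneous (elem_sym (Suc m) + linear_form l * elem_sym m)"
    unfolding homogeneous_def homogeneous_of_def by blast
  show "mpoly_eval (elem_sym (Suc m) + linear_form l * elem_sym m) 1 \<noteq> 0"
  proof -
    \<comment> \<open>By homogeneity \<open>pval (t 1)\<close> is a power of \<open>t\<close> times
      \<open>pval 1\<close>.\<close>
    obtain t where "t > 0" "pval (0 + t *\<^sub>R 1) > 0" using ex_pos_shift[of 0] by blast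
    then show ?thesis by (auto simp: mpoly_eval_eq_pval pval_scale)
  qed
qed (rule only_real_roots_line)

lemma spectrahedral_hyperbolicity_cone:
  "spectrahedral (hyperbolicity_cone 1 (elem_sym (Suc m) + linear_form l * elem_sym m))"
proof -
  let ?q = "\<lambda>(x :: real ^ 'n) w. net m UNIV (($) x) w + l x * (w [])\<^sup>2"
  have "hyperbolicity_cone 1 (elem_sym (Suc m) + linear_form l * elem_sym m) = {x. \<forall>w. ?q x w \<ge> 0}"
    \<comment> \<open>The two inclusions are \<open>net_psd\<close> and
      \<open>pval_shift_pos\<close>.\<close>
    unfolding hyperbolicity_cone_def mpoly_eval_eq_pval
    using pval_shift_pos net_psd by (fastforce simp: less_le)
  moreover have "linear_quadratic_form ?q"
    using linear_quadratic_form_add[OF linear_quadratic_form_net[of UNIV m]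
        linear_quadratic_form_single[OF lin, of "[]" "[]"]]
    by (simp add: power2_eq_square mult.assoc)
  ultimately show ?thesis
    using spectrahedral_linear_quadratic_form by simp
qed

end

theorem theorem1p13:
  fixes l :: "real ^ 'n \<Rightarrow> real" and k :: nat
  assumes "1 \<le> k" and "k \<le> CARD('n)"
    and "linear l" and "l 1 \<ge> 0"
  shows "hyperbolic (elem_sym k + linear_form l * elem_sym (k - 1)) 1 \<and>
         spectrahedral
           (hyperbolicity_cone 1 (elem_sym k + linear_form l * elem_sym (k - 1)))"
proof -
  \<comment> \<open>Since \<open>k\<close> is positive, the truncated difference
    \<open>k - 1\<close> is the true predecessor \<open>m\<close>.\<close>
  obtain m where "k = Suc m" using assms(1) by (cases k) auto
  then show ?thesis
    using hyperbolic_elem_sym_plus[of l m] spectrahedral_hyperbolicity_cone[of l m] assms by simp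
qed

end
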